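(* Let $X_1,X_2,\ldots$ be random variables on a probability scheme $(\Omega,\mathrm{pr})$, and let $\mathcal{A}$ be a unital $\mathbb{R}$-subalgebra of $\mathbb{R}^{\Omega}$. Suppose that $\mathrm{cov}_{\mathcal{A}}(X_i,X_j)=0$ for all $i\neq j$, and that there is $K\in\mathcal{A}$ such that $\mathrm{var}_{\mathcal{A}}X_i\le K$ pointwise for all $i$. Let $\bar X_n=\frac1n\sum_{i=1}^nX_i$. Then for all $n\ge1$ and $\varepsilon>0$, pointwise on $\Omega$, $$\mathrm{Pr}_{\mathcal{A}}\{|\bar X_n-\mathrm{E}_{\mathcal{A}}\bar X_n|\ge\varepsilon\}\le\frac{\mathrm{var}_{\mathcal{A}}\bar X_n}{\varepsilon^2}\le\frac{K}{n\varepsilon^2}.$$ In particular, if there is $\mu\in\mathcal{A}$ with $\mathrm{E}_{\mathcal{A}}X_i=\mu$ for all $i$, then $\mathrm{E}_{\mathcal{A}}\bar X_n=\mu$ and $$\mathrm{Pr}_{\mathcal{A}}\{|\bar X_n-\mu|\ge\varepsilon\}\le\frac{K}{n\varepsilon^2},$$ so that this conditional probability tends to $0$ as $n\to\infty$, pointwise on each atom of $\mathcal{A}$.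
   Context: A (probability) scheme is a finite set $\Omega$ with a function $\mathrm{pr}\colon\Omega\to(0,\infty)$ such that $\sum_{\omega}\mathrm{pr}(\omega)=1$. A random variable on $\Omega$ is an element of $\mathbb{R}^{\Omega}$, the real algebra of functions $\Omega\to\mathbb{R}$ under pointwise operations. For a unital $\mathbb{R}$-subalgebra $\mathcal{A}\subseteq\mathbb{R}^{\Omega}$, the atoms of $\mathcal{A}$ are the equivalence classes of the relation $\omega_1\equiv_{\mathcal{A}}\omega_2\iff X(\omega_1)=X(\omega_2)$ for all $X\in\mathcal{A}$. The conditional expectation relative to $\mathcal{A}$ is $\mathrm{E}_{\mathcal{A}}X=\sum_{A}\mathrm{E}(X|A)1_A$, the sum over atoms $A$, where $\mathrm{E}(X|A)=\frac{1}{\Pr(A)}\sum_{\omega\in A}X(\omega)\mathrm{pr}(\omega)$ and $\Pr(A)=\sum_{\omega\in A}\mathrm{pr}(\omega)$. Further, $\mathrm{cov}_{\mathcal{A}}(X,Y)=\mathrm{E}_{\mathcal{A}}\bigl((X-\mathrm{E}_{\mathcal{A}}X)(Y-\mathrm{E}_{\mathcal{A}}Y)\bigr)$, $\mathrm{var}_{\mathcal{A}}X=\mathrm{cov}_{\mathcal{A}}(X,X)$, and for an event $B\subseteq\Omega$, $\mathrm{Pr}_{\mathcal{A}}(B)=\mathrm{E}_{\mathcal{A}}1_B\in\mathcal{A}$. *)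

theory Defs
  imports Complex_Main "HOL-Library.Indicator_Function"
begin

text \<open>
  The sample space is a type \<open>'w\<close> of class \<open>finite\<close>, so that the algebra of random variables is
  the full function type \<open>'w \<Rightarrow> real\<close> and events are sets of type \<open>'w set\<close>.
\<close>

definition prob_scheme :: "('w::finite \<Rightarrow> real) \<Rightarrow> bool" where
  "prob_scheme pr \<longleftrightarrow> (\<forall>\<omega>. 0 < pr \<omega>) \<and> (\<Sum>\<omega>\<in>UNIV. pr \<omega>) = 1"

definition unital_subalgebra :: "('w \<Rightarrow> real) set \<Rightarrow> bool" where
  "unital_subalgebra \<A> \<longleftrightarrow>
     (\<lambda>\<omega>. 1) \<in> \<A> \<and>
     (\<forall>X\<in>\<A>. \<forall>Y\<in>\<A>. (\<lambda>\<omega>. X \<omega> + Y \<omega>) \<in> \<A>) \<and>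
     (\<forall>X\<in>\<A>. \<forall>Y\<in>\<A>. (\<lambda>\<omega>. X \<omega> * Y \<omega>) \<in> \<A>) \<and>
     (\<forall>c::real. \<forall>X\<in>\<A>. (\<lambda>\<omega>. c * X \<omega>) \<in> \<A>)"

definition alg_rel :: "('w \<Rightarrow> real) set \<Rightarrow> ('w \<times> 'w) set" where
  "alg_rel \<A> = {(\<omega>\<^sub>1, \<omega>\<^sub>2). \<forall>X\<in>\<A>. X \<omega>\<^sub>1 = X \<omega>\<^sub>2}"

definition atoms :: "('w \<Rightarrow> real) set \<Rightarrow> 'w set set" where
  "atoms \<A> = UNIV // alg_rel \<A>"

definition Pr :: "('w::finite \<Rightarrow> real) \<Rightarrow> 'w set \<Rightarrow> real" where
  "Pr pr B = (\<Sum>\<omega>\<in>B. pr \<omega>)"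

definition expect_given :: "('w::finite \<Rightarrow> real) \<Rightarrow> ('w \<Rightarrow> real) \<Rightarrow> 'w set \<Rightarrow> real" where
  "expect_given pr X B = 1 / Pr pr B * (\<Sum>\<omega>\<in>B. X \<omega> * pr \<omega>)"

definition cond_expect ::
  "('w::finite \<Rightarrow> real) \<Rightarrow> ('w \<Rightarrow> real) set \<Rightarrow> ('w \<Rightarrow> real) \<Rightarrow> 'w \<Rightarrow> real" where
  "cond_expect pr \<A> X = (\<lambda>\<omega>. \<Sum>A\<in>atoms \<A>. expect_given pr X A * indicator A \<omega>)"

definition cond_cov ::
  "('w::finite \<Rightarrow> real) \<Rightarrow> ('w \<Rightarrow> real) set \<Rightarrow> ('w \<Rightarrow> real) \<Rightarrow> ('w \<Rightarrow> real) \<Rightarrow> 'w \<Rightarrow> real" where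
  "cond_cov pr \<A> X Y =
     cond_expect pr \<A> (\<lambda>\<omega>. (X \<omega> - cond_expect pr \<A> X \<omega>) * (Y \<omega> - cond_expect pr \<A> Y \<omega>))"

definition cond_var ::
  "('w::finite \<Rightarrow> real) \<Rightarrow> ('w \<Rightarrow> real) set \<Rightarrow> ('w \<Rightarrow> real) \<Rightarrow> 'w \<Rightarrow> real" where
  "cond_var pr \<A> X = cond_cov pr \<A> X X"

definition cond_Pr ::
  "('w::finite \<Rightarrow> real) \<Rightarrow> ('w \<Rightarrow> real) set \<Rightarrow> 'w set \<Rightarrow> 'w \<Rightarrow> real" where
  "cond_Pr pr \<A> B = cond_expect pr \<A> (indicator B)"

text \<open>The sequence is indexed from 1; the value of \<open>X 0\<close> is irrelevant.\<close>

definition sample_mean :: "(nat \<Rightarrow> 'w \<Rightarrow> real) \<Rightarrow> nat \<Rightarrow> 'w \<Rightarrow> real" where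
  "sample_mean X n = (\<lambda>\<omega>. 1 / real n * (\<Sum>i=1..n. X i \<omega>))"

end

(* On the atom containing a fixed outcome, conditional expectation is a positive linear functional.
   Markov's inequality for the squared deviation is therefore monotonicity applied to a pointwise
   inequality, and bilinearity of the conditional covariance reduces the variance of the mean to a
   double sum in which only the diagonal survives. *)

theory Submission
  imports Defs
begin

lemma equiv_alg_rel: "equiv UNIV (alg_rel \<A>)"
  by (rule equivI) (auto simp: alg_rel_def intro!: refl_onI symI transI)

text \<open>The atoms partition the space, so at a given outcome every indicator in the defining sum
  vanishes except that of its own class. Linearity and monotonicity then become facts about finite
  weighted sums over one fixed class.\<close>

lemma cond_expect_eq_expect_given:
  fixes pr :: "'w::finite \<Rightarrow> real"
  shows "cond_expect pr \<A> X \<omega> = expect_given pr X (alg_rel \<A> `` {\<omega>})"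
proof -
  let ?C = "alg_rel \<A> `` {\<omega>}"
  have C: "?C \<in> atoms \<A>"
    unfolding atoms_def by (rule quotientI) simp
  have mem: "\<omega> \<in> ?C"
    by (rule equiv_class_self[OF equiv_alg_rel]) simp
  \<comment> \<open>Two classes that share a point coincide; the related pair demanded by
    \<open>quotient_eqI\<close> is the reflexive one.\<close>
  have unique: "A = ?C" if "A \<in> atoms \<A>" "\<omega> \<in> A" for A
  proof (rule quotient_eqI[OF equiv_alg_rel])
    show "A \<in> UNIV // alg_rel \<A>" "?C \<in> UNIV // alg_rel \<A>"
      using that(1) C by (simp_all only: atoms_def)
    show "\<omega> \<in> A" "\<omega> \<in> ?C"
      by (rule that(2), rule mem)
    show "(\<omega>, \<omega>) \<in> alg_rel \<A>"
      by (simp add: alg_rel_def)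
  qed
  have "expect_given pr X A * indicator A \<omega> = (if A = ?C then expect_given pr X A else 0)"
    if "A \<in> atoms \<A>" for A
    using unique[OF that] mem by (cases "A = ?C") (auto simp: indicator_def)
  then have "cond_expect pr \<A> X \<omega> = (\<Sum>A\<in>atoms \<A>. if A = ?C then expect_given pr X A else 0)"
    unfolding cond_expect_def by (rule sum.cong[OF refl])
  also have "\<dots> = expect_given pr X ?C"
    using C by (subst sum.delta) auto
  finally show ?thesis .
qed

lemma cond_expect_scale:
  "cond_expect pr \<A> (\<lambda>\<eta>. c * X \<eta>) \<omega> = c * cond_expect pr \<A> X \<omega>"
  unfolding cond_expect_eq_expect_given expect_given_def
  by (simp add: sum_distrib_left mult.assoc mult.left_commute)

lemma cond_expect_sum:
  "cond_expect pr \<A> (\<lambda>\<eta>. \<Sum>i\<in>I. X i \<eta>) \<omega> = (\<Sum>i\<in>I. cond_expect pr \<A> (X i) \<omega>)"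
  unfolding cond_expect_eq_expect_given expect_given_def
  by (subst sum_distrib_left[symmetric], subst sum.swap) (simp add: sum_distrib_right)

text \<open>The weights \<open>pr\<close> and the factor \<open>1 / Pr\<close> are nonnegative, so
  the inequality passes through the sum term by term.\<close>

lemma cond_expect_mono:
  assumes "prob_scheme pr" and "\<And>\<eta>. X \<eta> \<le> Y \<eta>"
  shows "cond_expect pr \<A> X \<omega> \<le> cond_expect pr \<A> Y \<omega>"
proof -
  have "0 \<le> pr \<eta>" for \<eta>
    using assms(1) by (simp add: prob_scheme_def less_imp_le)
  then show ?thesis
    unfolding cond_expect_eq_expect_given expect_given_def Pr_def
    by (intro mult_left_mono sum_mono mult_right_mono assms(2)) (auto intro: sum_nonneg)
qed

text \<open>Serves as the lower side of the squeeze in the final limit.\<close>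

lemma cond_Pr_nonneg:
  assumes "prob_scheme pr"
  shows "0 \<le> cond_Pr pr \<A> B \<omega>"
proof -
  have "cond_expect pr \<A> (\<lambda>_. 0) \<omega> \<le> cond_Pr pr \<A> B \<omega>"
    unfolding cond_Pr_def by (intro cond_expect_mono assms) simp
  then show ?thesis
    by (simp add: cond_expect_eq_expect_given expect_given_def)
qed

lemma conditional_chebyshev:
  assumes "prob_scheme pr" and "\<epsilon> > 0"
  shows "cond_Pr pr \<A> {\<eta>. \<bar>Y \<eta> - cond_expect pr \<A> Y \<eta>\<bar> \<ge> \<epsilon>} \<omega> \<le> cond_var pr \<A> Y \<omega> / \<epsilon>\<^sup>2"
proof -
  let ?D = "\<lambda>\<eta>. Y \<eta> - cond_expect pr \<A> Y \<eta>"
  \<comment> \<open>On the event the squared deviation is at least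
    \<open>\<epsilon>\<^sup>2\<close>; off it the left side is 0 and the right side is a nonnegative
    multiple of a square. The right side is written as a constant times a product so that
    \<open>cond_expect_scale\<close> applies and leaves exactly the body of
    \<open>cond_cov\<close>.\<close>
  have "indicator {\<eta>. \<bar>?D \<eta>\<bar> \<ge> \<epsilon>} \<eta> \<le> 1 / \<epsilon>\<^sup>2 * (?D \<eta> * ?D \<eta>)" for \<eta>
  proof (cases "\<bar>?D \<eta>\<bar> \<ge> \<epsilon>")
    case True
    then have "\<epsilon>\<^sup>2 \<le> \<bar>?D \<eta>\<bar>\<^sup>2"
      using assms(2) by (intro power_mono) auto
    then have "\<epsilon>\<^sup>2 \<le> ?D \<eta> * ?D \<eta>"
      unfolding power2_abs power2_eq_square[of "?D \<eta>"] .
    then have "1 \<le> ?D \<eta> * ?D \<eta> / \<epsilon>\<^sup>2"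
      using assms(2) by (subst le_divide_eq_1_pos) auto
    then show ?thesis
      using True by (simp only: indicator_def) simp
  qed (simp add: indicator_def)
  then have "cond_Pr pr \<A> {\<eta>. \<bar>?D \<eta>\<bar> \<ge> \<epsilon>} \<omega> \<le>
      cond_expect pr \<A> (\<lambda>\<eta>. 1 / \<epsilon>\<^sup>2 * (?D \<eta> * ?D \<eta>)) \<omega>"
    unfolding cond_Pr_def by (rule cond_expect_mono[OF assms(1)])
  then show ?thesis
    unfolding cond_expect_scale cond_var_def cond_cov_def by simp
qed

lemma cond_expect_sample_mean:
  "cond_expect pr \<A> (sample_mean X n) \<omega> = 1 / real n * (\<Sum>i=1..n. cond_expect pr \<A> (X i) \<omega>)"
  unfolding sample_mean_def cond_expect_scale cond_expect_sum ..

text \<open>Centring commutes with averaging, so the deviation of the mean is the mean of the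
  deviations \<open>?D i\<close>, and its square expands into a double sum.\<close>

lemma cond_var_sample_mean:
  "cond_var pr \<A> (sample_mean X n) \<omega> =
     1 / (real n)\<^sup>2 * (\<Sum>i=1..n. \<Sum>j=1..n. cond_cov pr \<A> (X i) (X j) \<omega>)"
proof -
  let ?D = "\<lambda>i \<eta>. X i \<eta> - cond_expect pr \<A> (X i) \<eta>"
  have dev: "sample_mean X n \<eta> - cond_expect pr \<A> (sample_mean X n) \<eta> =
      1 / real n * (\<Sum>i=1..n. ?D i \<eta>)" for \<eta>
    unfolding cond_expect_sample_mean
    by (simp add: sample_mean_def sum_subtractf diff_divide_distrib)
  \<comment> \<open>Moves both factors to the front, where \<open>cond_expect_scale\<close> can
    extract them; for n = 0 both sides are 0.\<close>
  have square: "1 / real n * a * (1 / real n * a) = 1 / (real n)\<^sup>2 * (a * a)" for a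
    by (simp add: power2_eq_square)
  show ?thesis
    unfolding cond_var_def cond_cov_def dev square sum_product cond_expect_scale cond_expect_sum ..
qed

text \<open>Works at one fixed outcome, so the bound is a real number \<open>k\<close>, later taken
  to be \<open>K \<omega>\<close>.\<close>

lemma cond_var_sample_mean_le:
  assumes "\<And>i j. i \<ge> 1 \<Longrightarrow> j \<ge> 1 \<Longrightarrow> i \<noteq> j \<Longrightarrow> cond_cov pr \<A> (X i) (X j) \<omega> = 0"
    and "\<And>i. i \<ge> 1 \<Longrightarrow> cond_var pr \<A> (X i) \<omega> \<le> k"
    and "n \<ge> 1"
  shows "cond_var pr \<A> (sample_mean X n) \<omega> \<le> k / real n"
proof -
  have "(\<Sum>j=1..n. cond_cov pr \<A> (X i) (X j) \<omega>) \<le> k" if "i \<in> {1..n}" for i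
  proof -
    \<comment> \<open>In row i only the diagonal entry, a variance, survives.\<close>
    have "(\<Sum>j=1..n. cond_cov pr \<A> (X i) (X j) \<omega>) =
        (\<Sum>j=1..n. if j = i then cond_var pr \<A> (X i) \<omega> else 0)"
      using that by (intro sum.cong) (auto simp: cond_var_def assms(1))
    then show ?thesis
      using that assms(2)[of i] by simp
  qed
  then have "(\<Sum>i=1..n. \<Sum>j=1..n. cond_cov pr \<A> (X i) (X j) \<omega>) \<le> (\<Sum>i=1..n. k)"
    by (rule sum_mono)
  \<comment> \<open>There are n rows, each at most \<open>k\<close>; the factor
    \<open>1 / (real n)\<^sup>2\<close> turns n times \<open>k\<close> into
    \<open>k / real n\<close>.\<close>
  then have "cond_var pr \<A> (sample_mean X n) \<omega> \<le> 1 / (real n)\<^sup>2 * (real n * k)"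
    unfolding cond_var_sample_mean by (intro mult_left_mono) auto
  also have "\<dots> = k / real n"
    using assms(3) by (simp add: power2_eq_square)
  finally show ?thesis .
qed

theorem mainTheorem10:
  fixes pr :: "'w::finite \<Rightarrow> real"
    and \<A> :: "('w \<Rightarrow> real) set"
    and X :: "nat \<Rightarrow> 'w \<Rightarrow> real"
    and K :: "'w \<Rightarrow> real"
  assumes "prob_scheme pr"
    and "unital_subalgebra \<A>"
    and "\<And>i j. i \<ge> 1 \<Longrightarrow> j \<ge> 1 \<Longrightarrow> i \<noteq> j \<Longrightarrow> cond_cov pr \<A> (X i) (X j) = (\<lambda>\<omega>. 0)"
    and "K \<in> \<A>"
    and "\<And>i \<omega>. i \<ge> 1 \<Longrightarrow> cond_var pr \<A> (X i) \<omega> \<le> K \<omega>"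
  shows "(\<forall>n\<ge>1. \<forall>\<epsilon>>0. \<forall>\<omega>.
            cond_Pr pr \<A> {\<eta>. \<bar>sample_mean X n \<eta> - cond_expect pr \<A> (sample_mean X n) \<eta>\<bar> \<ge> \<epsilon>} \<omega>
              \<le> cond_var pr \<A> (sample_mean X n) \<omega> / \<epsilon>\<^sup>2 \<and>
            cond_var pr \<A> (sample_mean X n) \<omega> / \<epsilon>\<^sup>2 \<le> K \<omega> / (real n * \<epsilon>\<^sup>2)) \<and>
         (\<forall>\<mu>\<in>\<A>. (\<forall>i\<ge>1. cond_expect pr \<A> (X i) = \<mu>) \<longrightarrow>
            (\<forall>n\<ge>1. cond_expect pr \<A> (sample_mean X n) = \<mu>) \<and>
            (\<forall>n\<ge>1. \<forall>\<epsilon>>0. \<forall>\<omega>.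
               cond_Pr pr \<A> {\<eta>. \<bar>sample_mean X n \<eta> - \<mu> \<eta>\<bar> \<ge> \<epsilon>} \<omega> \<le> K \<omega> / (real n * \<epsilon>\<^sup>2)) \<and>
            (\<forall>\<epsilon>>0. \<forall>A\<in>atoms \<A>. \<forall>\<omega>\<in>A.
               (\<lambda>n. cond_Pr pr \<A> {\<eta>. \<bar>sample_mean X n \<eta> - \<mu> \<eta>\<bar> \<ge> \<epsilon>} \<omega>) \<longlonglongrightarrow> 0))"
proof -
  have var_le: "cond_var pr \<A> (sample_mean X n) \<omega> / \<epsilon>\<^sup>2 \<le> K \<omega> / (real n * \<epsilon>\<^sup>2)"
    if "n \<ge> 1" for n \<omega> and \<epsilon> :: real
  proof -
    have "cond_var pr \<A> (sample_mean X n) \<omega> \<le> K \<omega> / real n"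
      using that by (intro cond_var_sample_mean_le assms(5)) (simp_all add: assms(3))
    then have "cond_var pr \<A> (sample_mean X n) \<omega> / \<epsilon>\<^sup>2 \<le> K \<omega> / real n / \<epsilon>\<^sup>2"
      by (rule divide_right_mono) simp
    then show ?thesis
      by simp
  qed
  note cheb = conditional_chebyshev[OF assms(1)]
  have "(\<forall>n\<ge>1. cond_expect pr \<A> (sample_mean X n) = \<mu>) \<and>
      (\<forall>n\<ge>1. \<forall>\<epsilon>>0. \<forall>\<omega>.
         cond_Pr pr \<A> {\<eta>. \<bar>sample_mean X n \<eta> - \<mu> \<eta>\<bar> \<ge> \<epsilon>} \<omega> \<le> K \<omega> / (real n * \<epsilon>\<^sup>2)) \<and>
      (\<forall>\<epsilon>>0. \<forall>A\<in>atoms \<A>. \<forall>\<omega>\<in>A.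
         (\<lambda>n. cond_Pr pr \<A> {\<eta>. \<bar>sample_mean X n \<eta> - \<mu> \<eta>\<bar> \<ge> \<epsilon>} \<omega>) \<longlonglongrightarrow> 0)"
    if \<mu>: "\<forall>i\<ge>1. cond_expect pr \<A> (X i) = \<mu>" for \<mu>
  proof -
    \<comment> \<open>An average of n copies of \<mu>. The restriction on n matters: for n = 0 the
      sample mean is the zero function.\<close>
    have mean: "cond_expect pr \<A> (sample_mean X n) = \<mu>" if "n \<ge> 1" for n
      using that \<mu> by (intro ext) (simp add: cond_expect_sample_mean)
    have bound: "cond_Pr pr \<A> {\<eta>. \<bar>sample_mean X n \<eta> - \<mu> \<eta>\<bar> \<ge> \<epsilon>} \<omega> \<le> K \<omega> / (real n * \<epsilon>\<^sup>2)"
      if "n \<ge> 1" "\<epsilon> > 0" for n \<epsilon> \<omega>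
      \<comment> \<open>The two general inequalities are chained first; rewriting with
        \<open>mean\<close> then replaces the centre of the event by \<mu>.\<close>
      using order_trans[OF cheb[OF that(2), where Y = "sample_mean X n"] var_le[OF that(1)]]
      unfolding mean[OF that(1)] .
    \<comment> \<open>Shown at an arbitrary outcome, which covers all outcomes of all atoms.\<close>
    have "(\<lambda>n. cond_Pr pr \<A> {\<eta>. \<bar>sample_mean X n \<eta> - \<mu> \<eta>\<bar> \<ge> \<epsilon>} \<omega>) \<longlonglongrightarrow> 0" if "\<epsilon> > 0" for \<epsilon> \<omega>
    proof (rule tendsto_sandwich[OF _ _ tendsto_const])
      show "\<forall>\<^sub>F n in sequentially. cond_Pr pr \<A> {\<eta>. \<bar>sample_mean X n \<eta> - \<mu> \<eta>\<bar> \<ge> \<epsilon>} \<omega>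
          \<le> K \<omega> / \<epsilon>\<^sup>2 / real n"
        \<comment> \<open>The upper bound is available only from n = 1 on: at n = 0 its right side
          is 0 by division by zero, while the probability may be positive.\<close>
        using eventually_ge_at_top[of 1]
        by eventually_elim (use bound that in \<open>simp add: mult.commute\<close>)
      show "(\<lambda>n. K \<omega> / \<epsilon>\<^sup>2 / real n) \<longlonglongrightarrow> 0"
        by (rule lim_const_over_n)
    qed (simp add: cond_Pr_nonneg[OF assms(1)])
    with mean bound show ?thesis
      by (intro conjI allI impI ballI)
  qed
  with cheb var_le show ?thesis
    by (intro conjI allI impI ballI) simp_all
qed

end
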